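(* Let $m\ge 2$, $n=2m$, $q=2^m$, let $\omega$ be a primitive element of $\mathbb{F}_{q^2}$ and $u=\omega^{(q-1)(2^{n-1}-1)}$ (a generator of $\mu_{q+1}$; the cosets $u^i\mathbb{F}_q^*$, $i\in\mathbb{Z}_{q+1}$, partition $\mathbb{F}_{q^2}^*$). Let $a_i\in\mathbb{F}_{q^2}$ and $l_i$ be non-negative integers for $i\in\mathbb{Z}_{q+1}$. Define $f(0)=0$ and $f(x)={\rm Tr}_1^n(a_ix^{l_i(q-1)})$ if $x\in u^i\mathbb{F}_q^*$, $i\in\mathbb{Z}_{q+1}$. Then $f$ is bent if and only if $\sum_{i\in\mathbb{Z}_{q+1}}(-1)^{{\rm Tr}_1^n(a_iu^{-2il_i})}=1$. Moreover, in that case the dual of $f$ is $\widetilde f(0)=0$ and $\widetilde{f}(x)={\rm Tr}_1^n(a_ix^{l_i(1-q)})$ if $x\ne0$ and $x^{q-1}=u^{2i}$, $i\in\mathbb{Z}_{q+1}$.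
   Context: ${\rm Tr}_1^k$ is the absolute trace of $\mathbb{F}_{2^k}$, $\mu_e=\{x:x^e=1\}$. The Walsh transform of $f:\mathbb{F}_{2^n}\to\mathbb{F}_2$ is $\widehat f(b)=\sum_{x}(-1)^{f(x)+{\rm Tr}_1^n(bx)}$; $f$ is bent if $|\widehat f(b)|=2^{n/2}$ for all $b$, and then its dual $\widetilde f$ is defined by $\widehat f(b)=2^{n/2}(-1)^{\widetilde f(b)}$. For $x\neq 0$, $x^{l(1-q)}$ means $(x^{-1})^{l(q-1)}$. *)

theory Defs
  imports Complex_Main "HOL-Library.Z2" "HOL-Computational_Algebra.Primes"
begin

text \<open>
  A field with \<open>2 ^ k\<close> elements is a type of class \<open>finite_field\<close> together with the assumption
  \<open>card UNIV = 2 ^ k\<close>; the field with two elements is the type \<open>bit\<close>.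
\<close>

text \<open>
  On a field with \<open>2 ^ k\<close> elements the sum \<open>x + x\<^sup>2 + x\<^sup>4 + \<dots> + x ^ 2 ^ (k - 1)\<close> lies in the prime
  field \<open>{0, 1}\<close> (lemma \<open>of_bool_abs_trace\<close>), which is identified with \<open>bit\<close>.
\<close>

definition abs_trace :: "nat \<Rightarrow> 'a::finite_field \<Rightarrow> bit" where
  "abs_trace k x = (if (\<Sum>i<k. x ^ (2 ^ i)) = 0 then 0 else 1)"

lemma of_bool_abs_trace:
  fixes x :: "'a::finite_field"
  assumes card: "card (UNIV :: 'a set) = 2 ^ k"
  shows "of_bool (abs_trace k x = 1) = (\<Sum>i<k. x ^ (2 ^ i))"
proof -
  have "(of_nat (card (UNIV :: 'a set)) :: 'a) = 0"
  proof -
    have "(\<Sum>y\<in>UNIV. y + (1::'a)) = (\<Sum>y\<in>UNIV. y)"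
      by (rule sum.reindex_bij_witness[of _ "\<lambda>y. y - 1" "\<lambda>y. y + 1"]) auto
    then show ?thesis
      by (simp add: sum.distrib)
  qed
  then have "(2::'a) ^ k = 0"
    by (simp add: card)
  then have two: "(2::'a) = 0"
    by simp
  then have "CHAR('a) dvd 2"
    by (metis of_nat_eq_0_iff_char_dvd of_nat_numeral)
  then have char: "CHAR('a) = 2"
    by (intro primes_dvd_imp_eq) simp_all
  define s where "s = (\<Sum>i<k. x ^ (2 ^ i))"
  have "s ^ 2 = (\<Sum>i<k. x ^ (2 ^ Suc i))"
  proof -
    have "s ^ 2 = (\<Sum>i<k. (x ^ (2 ^ i)) ^ 2)"
      unfolding s_def by (rule freshmans_dream_sum) (simp_all add: char)
    also have "\<dots> = (\<Sum>i<k. x ^ (2 ^ Suc i))"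
      by (intro sum.cong refl) (simp only: power_Suc2 flip: power_mult)
    finally show ?thesis .
  qed
  also have "\<dots> + x = s + x ^ (2 ^ k)"
    unfolding s_def
    using sum.lessThan_Suc_shift[of "\<lambda>i. x ^ (2 ^ i)" k] sum.lessThan_Suc[of "\<lambda>i. x ^ (2 ^ i)" k]
    by (simp only: power_0 power_one_right add.commute)
  also have "x ^ (2 ^ k) = x"
    using finite_field_power_card_eq_same[of x] card by simp
  finally have "s * (s - 1) = 0"
    by (simp add: power2_eq_square algebra_simps)
  then have "s = 0 \<or> s = 1"
    by auto
  then show ?thesis
    unfolding abs_trace_def s_def[symmetric] by auto
qed

definition bit_sign :: "bit \<Rightarrow> int" where
  "bit_sign c = (- 1) ^ (of_bool (c = 1))"

text \<open>The exponent in the Walsh transform is a sum in the two-element field.\<close>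

definition walsh :: "nat \<Rightarrow> ('a::finite_field \<Rightarrow> bit) \<Rightarrow> 'a \<Rightarrow> int" where
  "walsh n f b = (\<Sum>x\<in>UNIV. bit_sign (f x + abs_trace n (b * x)))"

definition bent :: "nat \<Rightarrow> ('a::finite_field \<Rightarrow> bit) \<Rightarrow> bool" where
  "bent n f \<longleftrightarrow> (\<forall>b. \<bar>real_of_int (walsh n f b)\<bar> = 2 powr (real n / 2))"

text \<open>
  Meaningful for bent functions only: these have exactly one value \<open>c\<close> as required.
\<close>

definition bent_dual :: "nat \<Rightarrow> ('a::finite_field \<Rightarrow> bit) \<Rightarrow> 'a \<Rightarrow> bit" where
  "bent_dual n f b =
     (THE c. real_of_int (walsh n f b) = 2 powr (real n / 2) * real_of_int (bit_sign c))"

definition primitive_element :: "'a::finite_field \<Rightarrow> bool" where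
  "primitive_element w \<longleftrightarrow> range (\<lambda>k::nat. w ^ k) = UNIV - {0}"

text \<open>
  The nonzero elements of the subfield with \<open>q\<close> elements, which consists of the roots
  of \<open>X ^ q - X\<close>.
\<close>

definition subfield_units :: "nat \<Rightarrow> 'a::finite_field set" where
  "subfield_units q = {x. x ^ q = x} - {0}"

end

theory Submission
  imports Defs "HOL-Computational_Algebra.Polynomial"
begin

text \<open>
  Since \<open>u ^ (q + 1) = 1\<close>, the function \<open>x ^ (q - 1)\<close> equals \<open>u ^ (- 2 * i)\<close> on the coset
  \<open>u ^ i * F\<^sub>q\<close>, so \<open>f\<close> is constant on every coset, with some sign \<open>s\<^sub>i\<close>. On \<open>F\<^sub>q\<close> the additive
  character \<open>y \<mapsto> Tr (c * y)\<close> is trivial iff \<open>c + c ^ q = 0\<close>, and for \<open>c = b * u ^ i\<close> and \<open>b \<noteq> 0\<close> this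
  happens for exactly one index \<open>j\<close>, the one with \<open>b ^ (q - 1) = u ^ (2 * j)\<close>. Hence, with
  \<open>S = (\<Sum>i. s\<^sub>i)\<close>, the Walsh transform is \<open>1 + (q - 1) * S\<close> at \<open>0\<close> and
  \<open>1 - S + q * s\<^sub>j\<close> at \<open>b\<close>. If \<open>S = 1\<close> these are \<open>q\<close> and \<open>q * s\<^sub>j\<close>; conversely
  \<open>1 + (q - 1) * S = \<plusminus>q\<close> forces \<open>S = 1\<close> because \<open>q - 1 > 2\<close> does not divide \<open>q + 1\<close>.
\<close>

section \<open>Characteristic two, signs and additivity of the trace\<close>

lemma char_finite_field_power_2:
  assumes card: "card (UNIV :: 'a::finite_field set) = 2 ^ k"
  shows "CHAR('a) = 2"
proof -
  have "prime CHAR('a)"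
    by (intro prime_CHAR_semidom finite_imp_CHAR_pos) simp
  \<comment> \<open>Translation by \<open>1\<close> permutes the field, so the sum of all elements
    is unchanged while gaining \<open>card UNIV\<close> copies of \<open>1\<close>; hence that
    number vanishes in the field.\<close>
  moreover have "(\<Sum>y\<in>UNIV. y + (1::'a)) = (\<Sum>y\<in>UNIV. y)"
    by (rule sum.reindex_bij_witness[of _ "\<lambda>y. y - 1" "\<lambda>y. y + 1"]) auto
  then have "(of_nat (2 ^ k) :: 'a) = 0"
    unfolding card[symmetric] by (simp add: sum.distrib)
  then have "CHAR('a) dvd 2 ^ k"
    by (simp only: of_nat_eq_0_iff_char_dvd)
  ultimately show ?thesis
    by (metis prime_dvd_power primes_dvd_imp_eq two_is_prime_nat)
qed

lemma add_power_char_2: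
  fixes x y :: "'a::comm_ring_1"
  assumes "CHAR('a) = 2"
  shows "(x + y) ^ (2 ^ i) = x ^ (2 ^ i) + y ^ (2 ^ i)"
  using freshmans_dream'[of "2 ^ i" i x y] assms by simp

lemma add_self_char_2:
  fixes x :: "'a::comm_ring_1"
  assumes "CHAR('a) = 2"
  shows "x + x = 0"
proof -
  have "(of_nat CHAR('a) :: 'a) = 0"
    by (rule of_nat_CHAR)
  then have "(2::'a) = 0"
    using assms by simp
  then show ?thesis
    by (metis mult_2 mult_zero_left)
qed

lemma bit_sign_add: "bit_sign (c + d) = bit_sign c * bit_sign d"
  by (cases c; cases d) (auto simp: bit_sign_def)

lemma bit_sign_simps [simp]: "bit_sign 0 = 1" "bit_sign 1 = -1"
  by (auto simp: bit_sign_def)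

lemma bit_sign_cases: "bit_sign c = 1 \<or> bit_sign c = -1"
  by (cases c) auto

lemma bit_sign_eq_iff: "bit_sign c = bit_sign d \<longleftrightarrow> c = d"
  by (cases c; cases d) auto

text \<open>The power sums are additive because squaring is. As \<open>abs_trace\<close> takes
  values in \<open>bit\<close>, additivity is carried over through the embedding
  \<open>of_bool\<close>, using \<open>1 + 1 = 0\<close> on both sides.\<close>

lemma abs_trace_add:
  fixes x y :: "'a::finite_field"
  assumes card: "card (UNIV :: 'a set) = 2 ^ k"
  shows "abs_trace k (x + y) = abs_trace k x + abs_trace k y"
proof -
  note char = char_finite_field_power_2[OF card]
  have "(\<Sum>i<k. (x + y) ^ (2 ^ i)) = (\<Sum>i<k. x ^ (2 ^ i)) + (\<Sum>i<k. y ^ (2 ^ i))"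
    by (simp add: add_power_char_2[OF char] sum.distrib)
  then have *: "(of_bool (abs_trace k (x + y) = 1) :: 'a) =
      of_bool (abs_trace k x = 1) + of_bool (abs_trace k y = 1)"
    by (simp add: of_bool_abs_trace[OF card])
  then show ?thesis
    using add_self_char_2[OF char, of 1]
    by (cases "abs_trace k x"; cases "abs_trace k y"; cases "abs_trace k (x + y)") simp_all
qed

lemma abs_trace_0 [simp]: "abs_trace k 0 = 0"
  by (simp add: abs_trace_def power_0_left)

section \<open>Character sums over the subfield\<close>

text \<open>Translation by \<open>z\<close> permutes \<open>K\<close> and flips every sign, so the
  sum equals its own negative.\<close>

lemma sum_bit_sign_subgroup:
  fixes K :: "'a::ab_group_add set" and \<psi> :: "'a \<Rightarrow> bit"
  assumes add: "\<And>x y. x \<in> K \<Longrightarrow> y \<in> K \<Longrightarrow> x + y \<in> K"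
    and uminus: "\<And>x. x \<in> K \<Longrightarrow> - x \<in> K"
    and hom: "\<And>x y. \<psi> (x + y) = \<psi> x + \<psi> y"
    and z: "z \<in> K" "\<psi> z = 1"
  shows "(\<Sum>y\<in>K. bit_sign (\<psi> y)) = 0"
proof -
  have "(\<Sum>y\<in>K. bit_sign (\<psi> y)) = (\<Sum>y\<in>K. bit_sign (\<psi> (y + z)))"
    by (rule sum.reindex_bij_witness[of _ "\<lambda>y. y + z" "\<lambda>y. y - z"])
      (use add uminus z(1) in \<open>auto simp flip: add_uminus_conv_diff\<close>)
  also have "\<dots> = - (\<Sum>y\<in>K. bit_sign (\<psi> y))"
    by (simp only: hom z(2) bit_sign_add bit_sign_simps mult_minus1_right sum_negf)
  finally show ?thesis
    by simp
qed

text \<open>Nondegeneracy of the trace: as a polynomial in \<open>y\<close> the sum has degree at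
  most \<open>2 ^ (m - 1)\<close>, too small for \<open>2 ^ m\<close> roots unless it is zero, and
  its linear coefficient is \<open>d\<close>.\<close>

lemma sum_powers_2_trivial_imp_0:
  fixes d :: "'a::{idom,finite}"
  assumes m: "m > 0" and K: "card K \<ge> 2 ^ m"
    and triv: "\<And>y. y \<in> K \<Longrightarrow> (\<Sum>i<m. (d * y) ^ (2 ^ i)) = 0"
  shows "d = 0"
proof -
  define p where "p = (\<Sum>i<m. monom (d ^ (2 ^ i)) (2 ^ i))"
  have poly_p: "poly p y = (\<Sum>i<m. (d * y) ^ (2 ^ i))" for y
    by (simp add: p_def poly_sum poly_monom power_mult_distrib)
  have "degree p \<le> 2 ^ (m - 1)"
    unfolding p_def
  proof (intro degree_sum_le)
    fix i assume "i \<in> {..<m}"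
    then have "(2::nat) ^ i \<le> 2 ^ (m - 1)"
      by (intro power_increasing) auto
    then show "degree (monom (d ^ (2 ^ i)) (2 ^ i)) \<le> 2 ^ (m - 1)"
      using degree_monom_le le_trans by blast
  qed simp
  also have "(2::nat) ^ (m - 1) < 2 ^ m"
    using m by (intro power_strict_increasing) auto
  finally have deg: "degree p < 2 ^ m" .
  have "p = 0"
  proof (rule ccontr)
    assume p: "p \<noteq> 0"
    have "card K \<le> card {x. poly p x = 0}"
      using triv poly_p by (intro card_mono) auto
    also have "\<dots> \<le> degree p"
      using p by (rule card_poly_roots_bound)
    finally show False
      using deg K by simp
  qed
  then have "0 = coeff p 1"
    by simp
  also have "\<dots> = (\<Sum>i<m. if i = 0 then d else 0)"
    unfolding p_def coeff_sum by (intro sum.cong) auto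
  also have "\<dots> = d"
    using m by (simp add: sum.delta)
  finally show ?thesis
    by simp
qed

text \<open>For \<open>y\<close> in the subfield, pairing the terms \<open>i\<close> and
  \<open>m + i\<close> turns the trace of \<open>c * y\<close> into the trace from the subfield of
  \<open>(c + c ^ q) * y\<close>, where \<open>q = 2 ^ m\<close>. This is identically zero, or else
  takes the value \<open>1\<close> somewhere and the signs cancel.\<close>

lemma sum_bit_sign_trace_subfield:
  fixes c :: "'a::finite_field"
  assumes m: "m > 0" and card: "card (UNIV :: 'a set) = 2 ^ (2 * m)"
    and cardK: "card {y::'a. y ^ (2 ^ m) = y} = 2 ^ m"
  shows "(\<Sum>y | y ^ (2 ^ m) = y. bit_sign (abs_trace (2 * m) (c * y))) =
           (if c + c ^ (2 ^ m) = 0 then 2 ^ m else 0)"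
proof -
  let ?K = "{y::'a. y ^ (2 ^ m) = y}"
  note char = char_finite_field_power_2[OF card]
  have trace: "(\<Sum>i<2 * m. (c * y) ^ (2 ^ i)) = (\<Sum>i<m. ((c + c ^ (2 ^ m)) * y) ^ (2 ^ i))"
    if "y \<in> ?K" for y
  proof -
    have "(\<Sum>i<2 * m. (c * y) ^ (2 ^ i)) =
        (\<Sum>i<m. (c * y) ^ (2 ^ i)) + (\<Sum>i<m. (c * y) ^ (2 ^ (m + i)))"
      using sum.atLeastLessThan_concat[of 0 m "m + m" "\<lambda>i. (c * y) ^ (2 ^ i)"]
        sum.shift_bounds_nat_ivl[of "\<lambda>i. (c * y) ^ (2 ^ i)" 0 m m]
      by (simp add: lessThan_atLeast0 mult_2 add.commute)
    also have "(\<Sum>i<m. (c * y) ^ (2 ^ (m + i))) = (\<Sum>i<m. (c ^ (2 ^ m) * y) ^ (2 ^ i))"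
    proof (intro sum.cong refl)
      fix i
      have "(c * y) ^ (2 ^ (m + i)) = ((c * y) ^ (2 ^ m)) ^ (2 ^ i)"
        by (simp add: power_add power_mult)
      also have "(c * y) ^ (2 ^ m) = c ^ (2 ^ m) * y"
        using that by (simp add: power_mult_distrib)
      finally show "(c * y) ^ (2 ^ (m + i)) = (c ^ (2 ^ m) * y) ^ (2 ^ i)" .
    qed
    finally show ?thesis
      by (simp add: distrib_right add_power_char_2[OF char] sum.distrib)
  qed
  show ?thesis
  proof (cases "c + c ^ (2 ^ m) = 0")
    case True
    then have "abs_trace (2 * m) (c * y) = 0" if "y \<in> ?K" for y
      using trace[OF that] by (simp add: abs_trace_def power_0_left)
    then have "(\<Sum>y\<in>?K. bit_sign (abs_trace (2 * m) (c * y))) = (\<Sum>y\<in>?K. 1)"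
      by (intro sum.cong) simp_all
    then show ?thesis
      using True cardK by simp
  next
    case False
    then obtain z where z: "z \<in> ?K" "(\<Sum>i<m. ((c + c ^ (2 ^ m)) * z) ^ (2 ^ i)) \<noteq> 0"
      using sum_powers_2_trivial_imp_0[OF m, of ?K "c + c ^ (2 ^ m)"] cardK by fastforce
    then have "abs_trace (2 * m) (c * z) = 1"
      using trace[OF z(1)] by (simp add: abs_trace_def)
    moreover have "- y \<in> ?K" if "y \<in> ?K" for y
      using that unfolding minus_unique[OF add_self_char_2[OF char]] .
    ultimately have "(\<Sum>y\<in>?K. bit_sign (abs_trace (2 * m) (c * y))) = 0"
      using z(1)
      by (intro sum_bit_sign_subgroup[where z = z])
        (auto simp: add_power_char_2[OF char] abs_trace_add[OF card] distrib_left)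
    then show ?thesis
      using False by simp
  qed
qed

section \<open>Powers of a primitive element and the partition into cosets\<close>

text \<open>Exponents reduce modulo \<open>card UNIV - 1\<close>, so the powers in this range
  already reach all nonzero elements; a surjection between finite sets of equal size is
  injective.\<close>

lemma primitive_element_inj_on:
  fixes \<omega> :: "'a::finite_field"
  assumes "primitive_element \<omega>"
  shows "inj_on (\<lambda>k::nat. \<omega> ^ k) {..<card (UNIV :: 'a set) - 1}"
proof -
  let ?N = "card (UNIV :: 'a set) - 1"
  have range: "range (\<lambda>k::nat. \<omega> ^ k) = UNIV - {0}"
    using assms by (simp add: primitive_element_def)
  then have nz: "\<omega> \<noteq> 0"
    by (metis Diff_iff insertI1 power_one_right rangeI)
  have N: "?N > 0"
    using card_mono[of UNIV "{0, 1 :: 'a}"] by simp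
  have "\<omega> ^ ?N * \<omega> = \<omega>"
    using finite_field_power_card_eq_same[of \<omega>] N by (simp flip: power_Suc2)
  then have one: "\<omega> ^ ?N = 1"
    using nz by simp
  have "\<omega> ^ k = \<omega> ^ (k mod ?N)" for k
  proof -
    have "\<omega> ^ k = \<omega> ^ (?N * (k div ?N) + k mod ?N)"
      by simp
    also have "\<dots> = \<omega> ^ (k mod ?N)"
      by (simp only: power_add power_mult one) simp
    finally show ?thesis .
  qed
  then have "range (\<lambda>k::nat. \<omega> ^ k) \<subseteq> (\<lambda>k. \<omega> ^ k) ` {..<?N}"
    using N by (metis image_eqI image_subsetI lessThan_iff mod_less_divisor)
  then have "(\<lambda>k. \<omega> ^ k) ` {..<?N} = UNIV - {0}"
    unfolding range[symmetric] by (rule subset_antisym[OF image_mono[OF subset_UNIV]])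
  then have "card ((\<lambda>k. \<omega> ^ k) ` {..<?N}) = card {..<?N}"
    by (simp only: card_Diff_singleton[OF UNIV_I] card_lessThan)
  then show ?thesis
    by (intro eq_card_imp_inj_on) simp_all
qed

locale polar_decomposition =
  fixes m q :: nat and \<omega> u :: "'a::finite_field"
  assumes m_pos: "m > 0"
    and q_eq: "q = 2 ^ m"
    and card_UNIV: "card (UNIV :: 'a set) = q ^ 2"
    and primitive: "primitive_element \<omega>"
    and u_eq: "u = \<omega> ^ ((q - 1) * (2 ^ (2 * m - 1) - 1))"
begin

definition coset :: "nat \<Rightarrow> 'a set" where
  "coset i = (\<lambda>y. u ^ i * y) ` subfield_units q"

lemma card_UNIV': "card (UNIV :: 'a set) = 2 ^ (2 * m)"
  by (simp add: card_UNIV q_eq mult.commute flip: power_mult)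

lemma q_ge_2: "q \<ge> 2"
  using power_increasing[of 1 m "2::nat"] m_pos by (simp add: q_eq)

lemma unit_power: "x ^ ((q - 1) * (q + 1)) = 1" if "x \<noteq> 0" for x :: 'a
proof -
  have "x ^ (q ^ 2) = x"
    using finite_field_power_card_eq_same[of x] by (simp add: card_UNIV)
  moreover have "q ^ 2 = Suc ((q - 1) * (q + 1))"
    using q_ge_2 by (cases q) (simp_all add: power2_eq_square)
  ultimately show ?thesis
    using that by simp
qed

lemma omega_nonzero: "\<omega> \<noteq> 0"
  using primitive unfolding primitive_element_def
  by (metis Diff_iff insertI1 power_one_right rangeI)

lemma u_nonzero: "u \<noteq> 0"
  using omega_nonzero by (simp add: u_eq)

lemma u_power_Suc_q: "u ^ (q + 1) = 1"
proof -
  have "u ^ (q + 1) = (\<omega> ^ (2 ^ (2 * m - 1) - 1)) ^ ((q - 1) * (q + 1))"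
    unfolding u_eq power_mult[symmetric] by (simp only: mult_ac)
  then show ?thesis
    using unit_power omega_nonzero by simp
qed

text \<open>This explains the exponent in \<open>u\<close>: since
  \<open>1 + 2 * (2 ^ (2 * m - 1) - 1) = q ^ 2 - 1\<close>, the element \<open>u\<close> is a square
  root of the inverse of \<open>\<omega> ^ (q - 1)\<close>.\<close>

lemma omega_u: "\<omega> ^ (q - 1) * u ^ 2 = 1"
proof -
  have "(2::nat) ^ (2 * m) = 2 * 2 ^ (2 * m - 1)"
    using m_pos by (cases m) simp_all
  moreover have "(2::nat) ^ (2 * m) = q ^ 2"
    by (simp add: q_eq mult.commute flip: power_mult)
  moreover have "(q - 1) * (q + 1) + 1 = q ^ 2"
    using q_ge_2 by (cases q) (simp_all add: power2_eq_square)
  ultimately have e: "1 + 2 * (2 ^ (2 * m - 1) - 1) = (q - 1) * (q + 1)"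
    using q_ge_2 by linarith
  have "x * (x ^ k) ^ 2 = x ^ (1 + 2 * k)" for x :: 'a and k
    by (simp add: mult.commute[of k] flip: power_mult)
  then have "\<omega> ^ (q - 1) * u ^ 2 = (\<omega> ^ (q - 1)) ^ (1 + 2 * (2 ^ (2 * m - 1) - 1))"
    unfolding u_eq power_mult .
  also have "\<dots> = (\<omega> ^ (q - 1)) ^ ((q - 1) * (q + 1))"
    by (simp only: e)
  finally show ?thesis
    using unit_power omega_nonzero by simp
qed

text \<open>If \<open>x = \<omega> ^ k\<close>, then \<open>x ^ (q - 1) = v ^ k\<close> with
  \<open>v = \<omega> ^ (q - 1)\<close>, and \<open>v ^ i\<close> is inverse to
  \<open>u ^ (2 * i)\<close>. As \<open>v ^ (q + 1) = 1\<close>, the index is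
  \<open>k mod (q + 1)\<close>.\<close>

lemma ex1_index:
  assumes "x \<noteq> (0::'a)"
  shows "\<exists>!i. i \<in> {0..q} \<and> x ^ (q - 1) * u ^ (2 * i) = 1"
proof -
  define v where "v = \<omega> ^ (q - 1)"
  obtain k where k: "x = \<omega> ^ k"
    using primitive assms
    unfolding primitive_element_def by (metis Diff_iff UNIV_I imageE singletonD)
  have v_order: "v ^ (q + 1) = 1"
    unfolding v_def power_mult[symmetric] by (rule unit_power[OF omega_nonzero])
  have vu: "v ^ i * u ^ (2 * i) = 1" for i
    using omega_u by (simp add: v_def power_mult flip: power_mult_distrib)
  have "v ^ k = v ^ ((q + 1) * (k div (q + 1)) + k mod (q + 1))"
    by (simp only: mult_div_mod_eq)
  also have "\<dots> = v ^ (k mod (q + 1))"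
    by (simp only: power_add[of v "_ * _"] power_mult v_order power_one mult_1_left)
  finally have "v ^ k = v ^ (k mod (q + 1))" .
  moreover have x: "x ^ (q - 1) = v ^ k"
    unfolding k v_def power_mult[symmetric] by (simp only: mult.commute)
  ultimately have ex: "x ^ (q - 1) * u ^ (2 * (k mod (q + 1))) = 1"
    using vu by simp
  have "i = j" if "i \<in> {0..q}" "j \<in> {0..q}" "x ^ (q - 1) * u ^ (2 * i) = 1"
    "x ^ (q - 1) * u ^ (2 * j) = 1" for i j
  proof -
    have "x ^ (q - 1) = v ^ i" "x ^ (q - 1) = v ^ j"
      using that(3,4) vu[of i] vu[of j] u_nonzero
      by (metis mult_right_cancel power_not_zero)+
    then have "\<omega> ^ ((q - 1) * i) = \<omega> ^ ((q - 1) * j)"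
      by (simp add: v_def power_mult)
    \<comment> \<open>Uniqueness: these exponents stay in the range where the powers of
      \<open>\<omega>\<close> are distinct.\<close>
    moreover have "(q - 1) * r < card (UNIV :: 'a set) - 1" if "r \<in> {0..q}" for r
    proof -
      have "(q - 1) * r \<le> (q - 1) * q"
        using that by simp
      also have "\<dots> < q ^ 2 - 1"
        using q_ge_2 by (cases q) (simp_all add: power2_eq_square)
      finally show ?thesis
        by (simp add: card_UNIV)
    qed
    ultimately have "(q - 1) * i = (q - 1) * j"
      using that(1,2) inj_onD[OF primitive_element_inj_on[OF primitive]]
      unfolding lessThan_iff by blast
    then show ?thesis
      using q_ge_2 by simp
  qed
  moreover have "k mod (q + 1) \<in> {0..q}"
    by (simp add: less_Suc_eq_le[symmetric])
  ultimately show ?thesis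
    using ex by blast
qed

lemma subfield_units_iff: "y \<in> subfield_units q \<longleftrightarrow> y \<noteq> 0 \<and> y ^ (q - 1) = 1" for y :: 'a
proof -
  have "y ^ q = y ^ (q - 1) * y"
    using q_ge_2 by (simp flip: power_Suc2)
  then show ?thesis
    by (auto simp: subfield_units_def)
qed

text \<open>From \<open>u ^ (q + 1) = 1\<close>, the power \<open>(u ^ i) ^ (q - 1)\<close> is
  inverse to \<open>u ^ (2 * i)\<close>; the product form avoids negative exponents.\<close>

lemma u_power_mult: "(u ^ i * y) ^ (q - 1) * u ^ (2 * i) = y ^ (q - 1)"
proof -
  have "q - 1 + 2 = q + 1"
    using q_ge_2 by simp
  then have "u ^ (q - 1) * u ^ 2 = 1"
    using u_power_Suc_q by (simp only: power_add[symmetric])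
  then have "(u ^ (q - 1) * u ^ 2) ^ i = 1"
    by simp
  then have "u ^ (i * (q - 1)) * u ^ (2 * i) = 1"
    by (simp add: power_mult_distrib mult.commute flip: power_mult)
  then show ?thesis
    by (simp add: power_mult_distrib mult_ac flip: power_mult)
qed

text \<open>The cosets are the fibres of \<open>x ^ (q - 1)\<close> on the nonzero elements, so
  \<open>ex1_index\<close> says that they form a partition.\<close>

lemma coset_iff: "x \<in> coset i \<longleftrightarrow> x \<noteq> 0 \<and> x ^ (q - 1) * u ^ (2 * i) = 1"
proof
  assume "x \<in> coset i"
  then show "x \<noteq> 0 \<and> x ^ (q - 1) * u ^ (2 * i) = 1"
    using u_power_mult u_nonzero by (auto simp: coset_def subfield_units_iff simp del: One_nat_def)
next
  assume x: "x \<noteq> 0 \<and> x ^ (q - 1) * u ^ (2 * i) = 1"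
  have *: "x = u ^ i * (x / u ^ i)"
    using u_nonzero by simp
  then have "(x / u ^ i) ^ (q - 1) = 1"
    using x u_power_mult[of i "x / u ^ i"] by simp
  then have "x / u ^ i \<in> subfield_units q"
    using x u_nonzero by (simp add: subfield_units_iff)
  then show "x \<in> coset i"
    unfolding coset_def using * by blast
qed

lemma sum_over_cosets:
  fixes g :: "'a \<Rightarrow> int"
  shows "(\<Sum>x\<in>UNIV. g x) = g 0 + (\<Sum>i\<in>{0..q}. \<Sum>y\<in>subfield_units q. g (u ^ i * y))"
proof -
  have "UNIV - {0} = (\<Union>i\<in>{0..q}. coset i)"
  proof (intro equalityI subsetI)
    fix x :: 'a assume "x \<in> UNIV - {0}"
    then show "x \<in> (\<Union>i\<in>{0..q}. coset i)"
      using ex1_index[of x] unfolding coset_iff UN_iff by blast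
  qed (auto simp: coset_iff)
  moreover have "coset i \<inter> coset j = {}" if "i \<in> {0..q}" "j \<in> {0..q}" "i \<noteq> j" for i j
  proof (rule equals0I)
    fix x assume "x \<in> coset i \<inter> coset j"
    then show False
      using ex1_index[of x] that unfolding coset_iff Int_iff by blast
  qed
  ultimately have "(\<Sum>x\<in>UNIV - {0}. g x) = (\<Sum>i\<in>{0..q}. \<Sum>x\<in>coset i. g x)"
    by (simp add: sum.UNION_disjoint)
  also have "\<dots> = (\<Sum>i\<in>{0..q}. \<Sum>y\<in>subfield_units q. g (u ^ i * y))"
    unfolding coset_def using u_nonzero by (simp add: sum.reindex inj_on_def)
  finally show ?thesis
    by (simp add: sum.remove[of UNIV 0])
qed

text \<open>Counting the field by cosets gives
  \<open>q ^ 2 = 1 + (q + 1) * card (subfield_units q)\<close>, which determines the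
  cardinality.\<close>

lemma card_subfield_units: "card (subfield_units q :: 'a set) = q - 1"
proof -
  have "int (q ^ 2) = 1 + (int q + 1) * int (card (subfield_units q :: 'a set))"
    using sum_over_cosets[of "\<lambda>_. 1"] by (simp add: card_UNIV)
  then have "(int q + 1) * int (card (subfield_units q :: 'a set)) = (int q + 1) * (int q - 1)"
    by (simp add: power2_eq_square algebra_simps)
  then have "int (card (subfield_units q :: 'a set)) = int q - 1"
    by (subst (asm) mult_left_cancel) simp_all
  then show ?thesis
    by simp
qed

lemma subfield_eq: "{y::'a. y ^ q = y} = insert 0 (subfield_units q)"
  using q_ge_2 by (auto simp: subfield_units_def power_0_left)

lemma sum_bit_sign_trace_subfield_units:
  "(\<Sum>y\<in>subfield_units q. bit_sign (abs_trace (2 * m) (c * y))) =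
     (if c + c ^ q = 0 then int q else 0) - 1" for c :: 'a
proof -
  have "card {y::'a. y ^ q = y} = q"
    unfolding subfield_eq using card_subfield_units q_ge_2
    by (simp add: card_insert_if subfield_units_def)
  then have "(\<Sum>y | y ^ q = y. bit_sign (abs_trace (2 * m) (c * y))) =
      (if c + c ^ q = 0 then int q else 0)"
    using sum_bit_sign_trace_subfield[OF m_pos card_UNIV', of c] by (simp add: q_eq)
  \<comment> \<open>Removing \<open>y = 0\<close>, whose sign is \<open>1\<close>, accounts for the
    \<open>- 1\<close>.\<close>
  then show ?thesis
    unfolding subfield_eq by (subst (asm) sum.insert) (simp_all add: subfield_units_def)
qed

text \<open>In characteristic two the left side says that \<open>b * u ^ i\<close> is fixed by the
  \<open>q\<close>-th power, hence that its power \<open>q - 1\<close> is \<open>1\<close>.\<close>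

lemma trace_condition:
  assumes "b \<noteq> 0"
  shows "b * u ^ i + (b * u ^ i) ^ q = 0 \<longleftrightarrow> b ^ (q - 1) = u ^ (2 * i)"
proof -
  let ?c = "b * u ^ i"
  note char = char_finite_field_power_2[OF card_UNIV']
  have c: "?c \<noteq> 0"
    using assms u_nonzero by simp
  have "?c + ?c ^ q = 0 \<longleftrightarrow> ?c ^ q = ?c"
    using add_self_char_2[OF char, of ?c] by (metis add_left_cancel)
  also have "\<dots> \<longleftrightarrow> ?c ^ (q - 1) = 1"
    using c subfield_units_iff[of ?c] by (simp add: subfield_units_def)
  also have "\<dots> \<longleftrightarrow> ?c ^ (q - 1) * u ^ (2 * i) = u ^ (2 * i)"
    using u_nonzero by simp
  also have "?c ^ (q - 1) * u ^ (2 * i) = b ^ (q - 1)"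
    using u_power_mult[of i b] by (simp only: mult.commute)
  finally show ?thesis .
qed

text \<open>The index belonging to \<open>b\<close> is that of the coset containing
  \<open>inverse b\<close>; this inversion is the source of the exponent \<open>l (1 - q)\<close> in
  the dual.\<close>

lemma ex1_dual_index:
  assumes "b \<noteq> 0"
  shows "\<exists>!i. i \<in> {0..q} \<and> b ^ (q - 1) = u ^ (2 * i)"
proof -
  have "inverse b ^ (q - 1) * u ^ (2 * i) = 1 \<longleftrightarrow> b ^ (q - 1) = u ^ (2 * i)" for i
    using assms by (auto simp: field_simps)
  then show ?thesis
    using ex1_index[of "inverse b"] assms by simp
qed

section \<open>The Walsh transform of a function that is constant on each coset\<close>

context
  fixes f :: "'a \<Rightarrow> bit" and c :: "nat \<Rightarrow> bit" and S :: int
  assumes f_0: "f 0 = 0"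
    and f_coset: "\<And>i x. i \<in> {0..q} \<Longrightarrow> x \<in> coset i \<Longrightarrow> f x = c i"
    and S_eq: "S = (\<Sum>i\<in>{0..q}. bit_sign (c i))"
begin

text \<open>With \<open>x = u ^ i * y\<close>, the sign of \<open>f\<close> leaves the inner sum,
  and a character sum over the subfield units remains. The leading \<open>1\<close> comes from
  \<open>x = 0\<close>.\<close>

lemma walsh_eq_sum:
  "walsh (2 * m) f b =
     1 + (\<Sum>i\<in>{0..q}. bit_sign (c i) *
            ((if b * u ^ i + (b * u ^ i) ^ q = 0 then int q else 0) - 1))"
proof -
  have "walsh (2 * m) f b = 1 + (\<Sum>i\<in>{0..q}. \<Sum>y\<in>subfield_units q.
      bit_sign (f (u ^ i * y) + abs_trace (2 * m) (b * (u ^ i * y))))"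
    unfolding walsh_def by (subst sum_over_cosets) (simp add: f_0)
  also have "(\<Sum>i\<in>{0..q}. \<Sum>y\<in>subfield_units q.
      bit_sign (f (u ^ i * y) + abs_trace (2 * m) (b * (u ^ i * y)))) =
      (\<Sum>i\<in>{0..q}. \<Sum>y\<in>subfield_units q.
        bit_sign (c i) * bit_sign (abs_trace (2 * m) (b * u ^ i * y)))"
  proof (intro sum.cong refl)
    fix i and y :: 'a assume "i \<in> {0..q}" "y \<in> subfield_units q"
    then have "f (u ^ i * y) = c i"
      by (intro f_coset) (auto simp: coset_def)
    then show "bit_sign (f (u ^ i * y) + abs_trace (2 * m) (b * (u ^ i * y))) =
        bit_sign (c i) * bit_sign (abs_trace (2 * m) (b * u ^ i * y))"
      by (simp only: bit_sign_add mult.assoc)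
  qed
  finally show ?thesis
    by (simp only: sum_distrib_left[symmetric] sum_bit_sign_trace_subfield_units)
qed

lemma walsh_0: "walsh (2 * m) f 0 = 1 + (int q - 1) * S"
  unfolding walsh_eq_sum S_eq using q_ge_2
  by (simp add: power_0_left sum_distrib_left mult.commute)

text \<open>Only the term of index \<open>i\<close> satisfies the trace condition and receives the
  extra \<open>q\<close>; the \<open>- 1\<close> in all terms adds up to \<open>- S\<close>.\<close>

lemma walsh_nonzero:
  assumes "b \<noteq> 0" "i \<in> {0..q}" "b ^ (q - 1) = u ^ (2 * i)"
  shows "walsh (2 * m) f b = 1 - S + int q * bit_sign (c i)"
proof -
  have "b ^ (q - 1) = u ^ (2 * j) \<longleftrightarrow> j = i" if "j \<in> {0..q}" for j
    using ex1_dual_index[OF assms(1)] assms(2,3) that by blast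
  then have "walsh (2 * m) f b =
      1 + (\<Sum>j\<in>{0..q}. (if j = i then int q * bit_sign (c j) else 0) - bit_sign (c j))"
    unfolding walsh_eq_sum trace_condition[OF assms(1)]
    by (intro arg_cong2[of _ _ _ _ "(+)"] sum.cong refl) (auto simp: algebra_simps)
  then show ?thesis
    using assms(2) by (simp add: sum_subtractf S_eq)
qed

lemma powr_half_eq: "2 powr (real (2 * m) / 2) = real q"
  by (simp add: q_eq powr_realpow)

lemma bent_imp_sum_eq_1:
  assumes "m \<ge> 2" "bent (2 * m) f"
  shows "S = 1"
proof -
  have q4: "q \<ge> 4"
    using power_increasing[of 2 m "2::nat"] assms(1) by (simp add: q_eq)
  have "\<bar>real_of_int (walsh (2 * m) f 0)\<bar> = real q"
    using assms(2) by (simp add: bent_def powr_half_eq[simplified])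
  then have "\<bar>1 + (int q - 1) * S\<bar> = int q"
    unfolding walsh_0 by linarith
  \<comment> \<open>The two signs of the value at \<open>0\<close>. The negative one would make
    \<open>q - 1\<close>, which is at least \<open>3\<close>, a divisor of \<open>2\<close>.\<close>
  then consider "(int q - 1) * S = (int q - 1) * 1" | "(int q - 1) * (- S - 1) = 2"
    by (cases "1 + (int q - 1) * S \<ge> 0") (simp_all add: algebra_simps)
  then show ?thesis
  proof cases
    case 1
    then show ?thesis
      using q4 by (subst (asm) mult_left_cancel) simp_all
  next
    case 2
    then have "int q - 1 dvd 2"
      by (metis dvd_triv_left)
    then have "int q - 1 \<le> 2"
      by (rule zdvd_imp_le) simp
    then show ?thesis
      using q4 by simp
  qed
qed

lemma walsh_if_sum_eq_1:
  assumes "S = 1"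
  shows "walsh (2 * m) f 0 = int q"
    and "b \<noteq> 0 \<Longrightarrow> i \<in> {0..q} \<Longrightarrow> b ^ (q - 1) = u ^ (2 * i) \<Longrightarrow>
           walsh (2 * m) f b = int q * bit_sign (c i)"
  using assms by (simp_all add: walsh_0 walsh_nonzero)

lemma sum_eq_1_imp_bent:
  assumes "S = 1"
  shows "bent (2 * m) f"
  unfolding bent_def powr_half_eq
proof
  fix b :: 'a
  show "\<bar>real_of_int (walsh (2 * m) f b)\<bar> = real q"
  proof (cases "b = 0")
    case True
    then show ?thesis
      using walsh_if_sum_eq_1(1)[OF assms] by simp
  next
    case False
    then obtain i where "i \<in> {0..q}" "b ^ (q - 1) = u ^ (2 * i)"
      using ex1_dual_index by blast
    then show ?thesis
      using walsh_if_sum_eq_1(2)[OF assms False] bit_sign_cases[of "c i"] by auto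
  qed
qed

lemma bent_dual_eqI:
  assumes "walsh (2 * m) f b = int q * bit_sign d"
  shows "bent_dual (2 * m) f b = d"
  unfolding bent_dual_def powr_half_eq assms
  using q_ge_2 by (intro the_equality) (auto simp: bit_sign_eq_iff)

lemma bent_dual_if_sum_eq_1:
  assumes "S = 1"
  shows "bent_dual (2 * m) f 0 = 0"
    and "b \<noteq> 0 \<Longrightarrow> i \<in> {0..q} \<Longrightarrow> b ^ (q - 1) = u ^ (2 * i) \<Longrightarrow>
           bent_dual (2 * m) f b = c i"
  by (rule bent_dual_eqI, use walsh_if_sum_eq_1[OF assms] in simp)+

end

end

theorem theorem3p2:
  fixes m n q :: nat
    and \<omega> u :: "'a::finite_field"
    and a :: "nat \<Rightarrow> 'a"
    and l :: "nat \<Rightarrow> nat"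
    and f :: "'a \<Rightarrow> bit"
  assumes m: "m \<ge> 2"
    and n: "n = 2 * m"
    and q: "q = 2 ^ m"
    and card: "card (UNIV :: 'a set) = q ^ 2"
    and \<omega>: "primitive_element \<omega>"
    and u: "u = \<omega> ^ ((q - 1) * (2 ^ (n - 1) - 1))"
    and f_0: "f 0 = 0"
    and f_coset: "\<And>i x. i \<in> {0..q} \<Longrightarrow> x \<in> (\<lambda>y. u ^ i * y) ` subfield_units q \<Longrightarrow>
                    f x = abs_trace n (a i * x ^ (l i * (q - 1)))"
  shows "(bent n f \<longleftrightarrow>
            (\<Sum>i\<in>{0..q}. bit_sign (abs_trace n (a i * u powi (- (2 * int i * int (l i)))))) = 1)
       \<and> (bent n f \<longrightarrow>
            bent_dual n f 0 = 0 \<and>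
            (\<forall>x. \<forall>i\<in>{0..q}. x \<noteq> 0 \<and> x ^ (q - 1) = u ^ (2 * i) \<longrightarrow>
               bent_dual n f x = abs_trace n (a i * (inverse x) ^ (l i * (q - 1)))))"
proof -
  interpret polar_decomposition m q \<omega> u
    using assms by unfold_locales simp_all
  \<comment> \<open>The value of \<open>f\<close> on the coset of index \<open>i\<close>, where
    \<open>x ^ (q - 1)\<close> is the inverse of \<open>u ^ (2 * i)\<close>.\<close>
  define c where "c i = abs_trace n (a i * u powi (- (2 * int i * int (l i))))" for i
  have powi: "u powi (- (2 * int i * int (l i))) = inverse (u ^ (2 * i)) ^ l i" for i
  proof -
    have "2 * int i * int (l i) = int (2 * i * l i)"
      by simp
    then show ?thesis
      by (simp only: power_int_minus power_int_of_nat power_mult power_inverse)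
  qed
  have f_c: "f x = c i" if "i \<in> {0..q}" "x \<in> coset i" for i x
  proof -
    have "x ^ (q - 1) = inverse (u ^ (2 * i))"
      using that(2) inverse_unique[of "u ^ (2 * i)" "x ^ (q - 1)"]
      by (simp add: coset_iff mult.commute)
    then have "x ^ (l i * (q - 1)) = u powi (- (2 * int i * int (l i)))"
      unfolding powi by (simp only: mult.commute[of "l i"] power_mult)
    then show ?thesis
      using f_coset[OF that(1), of x] that(2) by (simp add: c_def coset_def)
  qed
  \<comment> \<open>Here \<open>inverse x\<close> lies in the coset of index \<open>i\<close>
    whenever \<open>x\<close> is nonzero, so the proposed dual takes the value of \<open>f\<close>
    on that coset.\<close>
  have dual_c: "abs_trace n (a i * (inverse x) ^ (l i * (q - 1))) = c i"
    if "x ^ (q - 1) = u ^ (2 * i)" for x i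
    unfolding c_def powi that[symmetric]
    by (simp only: mult.commute[of "l i"] power_mult power_inverse)
  have iff: "bent n f \<longleftrightarrow> (\<Sum>i\<in>{0..q}. bit_sign (c i)) = 1"
    using bent_imp_sum_eq_1[where f = f and c = c, OF f_0 f_c refl m]
      sum_eq_1_imp_bent[where f = f and c = c, OF f_0 f_c refl]
    unfolding n by blast
  moreover have "bent_dual n f 0 = 0 \<and>
      (\<forall>x. \<forall>i\<in>{0..q}. x \<noteq> 0 \<and> x ^ (q - 1) = u ^ (2 * i) \<longrightarrow>
         bent_dual n f x = abs_trace n (a i * (inverse x) ^ (l i * (q - 1))))"
    if "bent n f"
  proof -
    have S: "(\<Sum>i\<in>{0..q}. bit_sign (c i)) = 1"
      using that iff by blast
    show ?thesis
      using bent_dual_if_sum_eq_1[where f = f and c = c, OF f_0 f_c refl S] dual_c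
      unfolding n[symmetric] by auto
  qed
  ultimately show ?thesis
    unfolding c_def by blast
qed

end
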